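(* For each $1\le i\le n$, the nonlinear variational problem: find ${\bf P}_i\in Y$ such that $$\tau(\delta{\bf P}_i,{\bf \Psi})+(f({\bf P}_i),{\bf \Psi})=\epsilon_0(\epsilon_s-\epsilon_\infty)({\bf E}_i,{\bf \Psi})\qquad\text{for all }{\bf \Psi}\in Y,$$ (where ${\bf P}_{i-1}\in Y$ and ${\bf E}_i\in X$ are already known) has a unique solution ${\bf P}_i\in Y$.
   Context: Setting. Let $d\in\{2,3\}$, $\Omega\subset\mathbb{R}^d$ a bounded, convex, simply connected Lipschitz polyhedron, $T>0$, and $\epsilon_0,\mu_0,\tau,\epsilon_s,\epsilon_\infty$ positive physical constants. Write $Y=(L^2(\Omega))^d$, with $(\cdot,\cdot)$ and $\|\cdot\|_0$ the $L^2$ inner product and norm, and $X=H_0(\mathrm{curl},\Omega)=\{{\bf u}\in Y:\nabla\times{\bf u}\in L^2(\Omega),\ {\bf u}\times{\bf n}=0\text{ on }\partial\Omega\}$. The nonlinearity $f:\mathbb{R}^d\to\mathbb{R}^d$ is $C^1$, $f(0)=0$, $0<f'(x)<B$ for all $x$ with a fixed constant $B>0$ (where $f'(x)$ is the Jacobian, and this means $0<\xi\cdot f'(x)\xi<B|\xi|^2$ for all $\xi\neq0$), and there are constants $\omega_f,C_L,M>0$ with $(f(x)-f(y))\cdot(x-y)\ge\omega_f|x-y|^2$, $|f(x)-f(y)|\le C_L|x-y|$, $|f(x)|\le M|x|$ for all $x,y\in\mathbb{R}^d$. Time discretization: $n$ is a positive integer, $\Delta t=T/n$, and $\delta{\bf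 P}_i=({\bf P}_i-{\bf P}_{i-1})/\Delta t$, with given ${\bf P}_0\in Y$. The functions ${\bf E}_i\in X$ are the electric fields computed at step $i$ of the decoupled semi-discrete scheme (before ${\bf P}_i$). *)

theory Defs
  imports "HOL-Analysis.Analysis"
begin

(* Elements of \<open>L2 \<Omega>\<close> are functions on the whole space of which only the restriction to
   \<open>\<Omega>\<close> matters; no quotient is taken, so equality of L^2 functions is equality almost
   everywhere with respect to \<open>lebesgue_on \<Omega>\<close>. *)

definition L2 :: "'a::euclidean_space set \<Rightarrow> ('a \<Rightarrow> 'b::euclidean_space) set" where
  "L2 \<Omega> = {u. u \<in> borel_measurable (lebesgue_on \<Omega>) \<and>
               integrable (lebesgue_on \<Omega>) (\<lambda>x. (norm (u x))\<^sup>2)}"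

definition L2_inner ::
  "'a::euclidean_space set \<Rightarrow> ('a \<Rightarrow> 'b::euclidean_space) \<Rightarrow> ('a \<Rightarrow> 'b) \<Rightarrow> real" where
  "L2_inner \<Omega> u v = (LINT x|lebesgue_on \<Omega>. u x \<bullet> v x)"

definition partial_deriv :: "'d::finite \<Rightarrow> (real^'d \<Rightarrow> real) \<Rightarrow> real^'d \<Rightarrow> real" where
  "partial_deriv j \<phi> x = frechet_derivative \<phi> (at x) (axis j 1)"

fun Ck :: "nat \<Rightarrow> (real^'d::finite \<Rightarrow> real) \<Rightarrow> bool" where
  "Ck 0 \<phi> \<longleftrightarrow> continuous_on UNIV \<phi>"
| "Ck (Suc k) \<phi> \<longleftrightarrow> (\<forall>x. \<phi> differentiable (at x)) \<and> (\<forall>j. Ck k (partial_deriv j \<phi>))"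

definition smooth :: "(real^'d::finite \<Rightarrow> real) \<Rightarrow> bool" where
  "smooth \<phi> \<longleftrightarrow> (\<forall>k. Ck k \<phi>)"

definition test_function :: "(real^'d::finite) set \<Rightarrow> (real^'d \<Rightarrow> real) \<Rightarrow> bool" where
  "test_function \<Omega> \<phi> \<longleftrightarrow> smooth \<phi> \<and> compact (closure {x. \<phi> x \<noteq> 0}) \<and> closure {x. \<phi> x \<noteq> 0} \<subseteq> \<Omega>"

(* The curl of \<open>u\<close> is represented, uniformly in the dimension, by the matrix field \<open>C\<close> with
   entries \<open>C_jk = d_j u_k - d_k u_j\<close>. For d = 3 the classical curl is \<open>(C_23, C_31, C_12)\<close>, for
   d = 2 the scalar curl is \<open>C_12\<close>; the other entries are the negatives of these, or zero.
   By Green's formula the following quantity equals the integral of \<open>(n_j u_k - n_k u_j) \<phi>\<close>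
   over the boundary for smooth \<open>u\<close>, so it is the pairing of the tangential trace with \<open>\<phi>\<close>:
   the boundary integrand consists, up to sign, of the components of u x n times \<open>\<phi>\<close>. *)

definition tangential_trace ::
  "(real^'d::finite) set \<Rightarrow> (real^'d \<Rightarrow> real^'d) \<Rightarrow> (real^'d \<Rightarrow> real^'d^'d) \<Rightarrow>
   'd \<Rightarrow> 'd \<Rightarrow> (real^'d \<Rightarrow> real) \<Rightarrow> real" where
  "tangential_trace \<Omega> u C j k \<phi> =
     (LINT x|lebesgue_on \<Omega>. C x $ j $ k * \<phi> x
        + u x $ k * partial_deriv j \<phi> x - u x $ j * partial_deriv k \<phi> x)"

definition has_weak_curl ::
  "(real^'d::finite) set \<Rightarrow> (real^'d \<Rightarrow> real^'d) \<Rightarrow> (real^'d \<Rightarrow> real^'d^'d) \<Rightarrow> bool" where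
  "has_weak_curl \<Omega> u C \<longleftrightarrow>
     (\<forall>\<phi>. test_function \<Omega> \<phi> \<longrightarrow> (\<forall>j k. tangential_trace \<Omega> u C j k \<phi> = 0))"

(* The trace condition is tested against restrictions to \<open>\<Omega>\<close> of smooth functions on the whole
   space, which need not vanish on the boundary. *)

definition H0_curl :: "(real^'d::finite) set \<Rightarrow> (real^'d \<Rightarrow> real^'d) set" where
  "H0_curl \<Omega> = {u \<in> L2 \<Omega>. \<exists>C \<in> L2 \<Omega>. has_weak_curl \<Omega> u C \<and>
     (\<forall>\<phi>. smooth \<phi> \<longrightarrow> (\<forall>j k. tangential_trace \<Omega> u C j k \<phi> = 0))}"

(* Near each boundary point, \<open>\<Omega>\<close> is the strict epigraph, in some direction \<open>e\<close>, of a Lipschitz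
   function of the projection onto the orthogonal complement of \<open>e\<close>. *)

definition lipschitz_boundary :: "'a::euclidean_space set \<Rightarrow> bool" where
  "lipschitz_boundary \<Omega> \<longleftrightarrow>
     (\<forall>x0 \<in> frontier \<Omega>. \<exists>U e L g. open U \<and> x0 \<in> U \<and> norm e = 1 \<and>
        L-lipschitz_on UNIV (g :: 'a \<Rightarrow> real) \<and>
        \<Omega> \<inter> U = {x \<in> U. x \<bullet> e > g (x - (x \<bullet> e) *\<^sub>R e)})"

(* The polyhedral condition is imposed on the closure, since \<open>polyhedron\<close> in the library means a
   finite intersection of closed half-spaces. *)

definition convex_polyhedral_domain :: "'a::euclidean_space set \<Rightarrow> bool" where
  "convex_polyhedral_domain \<Omega> \<longleftrightarrow>
     open \<Omega> \<and> \<Omega> \<noteq> {} \<and> bounded \<Omega> \<and> convex \<Omega> \<and> simply_connected \<Omega> \<and>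
     lipschitz_boundary \<Omega> \<and> polyhedron (closure \<Omega>)"

definition solves_polarization_step ::
  "(real^'d::finite) set \<Rightarrow> (real^'d \<Rightarrow> real^'d) \<Rightarrow> real \<Rightarrow> real \<Rightarrow> real \<Rightarrow>
   (real^'d \<Rightarrow> real^'d) \<Rightarrow> (real^'d \<Rightarrow> real^'d) \<Rightarrow> (real^'d \<Rightarrow> real^'d) \<Rightarrow> bool" where
  "solves_polarization_step \<Omega> f tau c dt P_prev E P \<longleftrightarrow>
     P \<in> L2 \<Omega> \<and>
     (\<forall>\<Psi> \<in> L2 \<Omega>. tau * L2_inner \<Omega> (\<lambda>x. (P x - P_prev x) /\<^sub>R dt) \<Psi> + L2_inner \<Omega> (\<lambda>x. f (P x)) \<Psi>
                  = c * L2_inner \<Omega> E \<Psi>)"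

end

theory Submission
  imports Defs
begin

text \<open>
  The variational equation contains no derivatives of the unknown, so it decouples into one
  algebraic equation for each point of \<open>\<Omega>\<close>. Put \<open>a = tau / dt\<close>,
  \<open>G p = a p + f p\<close> and \<open>b x = a P_prev x + c E x\<close>. The weak equation says that the
  \<open>L2\<close> field \<open>G \<circ> P - b\<close> is orthogonal to all of \<open>L2\<close>; testing with the field
  itself shows that this is the same as \<open>G (P x) = b x\<close> for almost every \<open>x\<close>
  (lemma \<open>solves_polarization_step_iff\<close>).

  The map \<open>G\<close> is strongly monotone and Lipschitz continuous on a finite-dimensional space.
  By Zarantonello's theorem (lemma \<open>strongly_monotone_lipschitz_bij\<close>) it is a bijection,
  and monotonicity makes its inverse Lipschitz continuous with \<open>G\<^sup>-\<^sup>1 0 = 0\<close>. Hence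
  \<open>G\<^sup>-\<^sup>1 \<circ> b\<close> is again in \<open>L2\<close>, it solves the problem, and every
  solution agrees with it almost everywhere.
\<close>

section \<open>Strongly monotone maps\<close>

lemma strongly_monotone_expanding:
  fixes G :: "'a::real_inner \<Rightarrow> 'a"
  assumes mono: "\<And>x y. (G x - G y) \<bullet> (x - y) \<ge> m * (norm (x - y))\<^sup>2"
  shows "m * norm (x - y) \<le> norm (G x - G y)"
proof (cases "x = y")
  case False
  have "m * norm (x - y) * norm (x - y) \<le> (G x - G y) \<bullet> (x - y)"
    using mono[of x y] by (simp add: power2_eq_square)
  also have "\<dots> \<le> norm (G x - G y) * norm (x - y)"
    by (rule norm_cauchy_schwarz)
  finally show ?thesis using False by simp
qed simp

text \<open>
  Surjectivity comes from the Banach fixed point theorem: \<open>G x = b\<close> is the fixed point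
  equation of \<open>x \<mapsto> x - r (G x - b)\<close>, and expanding the square of the norm shows that
  this map has squared Lipschitz constant at most \<open>1 - 2 r m + r\<^sup>2 L\<^sup>2\<close>, which is
  smaller than \<open>1\<close> for small \<open>r > 0\<close>.
\<close>

lemma strongly_monotone_lipschitz_bij:
  fixes G :: "'a::{real_inner, banach} \<Rightarrow> 'a"
  assumes "m > 0"
    and mono: "\<And>x y. (G x - G y) \<bullet> (x - y) \<ge> m * (norm (x - y))\<^sup>2"
    and lip: "\<And>x y. norm (G x - G y) \<le> L * norm (x - y)"
  shows "bij G"
proof (rule bijI)
  show "inj G"
  proof (rule injI)
    fix x y assume "G x = G y"
    then have "m * norm (x - y) \<le> 0"
      using strongly_monotone_expanding[of m G x y] mono by simp
    then show "x = y" using \<open>m > 0\<close> by (simp add: mult_le_0_iff)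
  qed
  show "surj G"
    unfolding surj_def
  proof
    fix b
    \<comment> \<open>Enlarging the Lipschitz constant to at least \<open>m\<close> keeps the radicand of \<open>q\<close>
      nonnegative; \<open>r = m / K\<^sup>2\<close> minimizes \<open>1 - 2 r m + r\<^sup>2 K\<^sup>2\<close>.\<close>
    define K where "K = max L m"
    define r where "r = m / K\<^sup>2"
    define q where "q = sqrt (1 - m\<^sup>2 / K\<^sup>2)"
    define F where "F x = x - r *\<^sub>R (G x - b)" for x
    have K: "K > 0" "m \<le> K" "L \<le> K" using \<open>m > 0\<close> by (auto simp: K_def)
    have r: "r > 0" using K \<open>m > 0\<close> by (simp add: r_def)
    have ratio: "0 < m\<^sup>2 / K\<^sup>2" "m\<^sup>2 / K\<^sup>2 \<le> 1"
      using K \<open>m > 0\<close> by (auto simp: power_mono)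
    have q: "0 \<le> q" "q < 1" using ratio by (auto simp: q_def)
    have lipK: "norm (G x - G y) \<le> K * norm (x - y)" for x y
      using lip[of x y] mult_right_mono[OF K(3), of "norm (x - y)"] by simp
    have contr: "dist (F x) (F y) \<le> q * dist x y" for x y
    proof -
      have "(norm (F x - F y))\<^sup>2 = (norm ((x - y) - r *\<^sub>R (G x - G y)))\<^sup>2"
        by (simp add: F_def algebra_simps)
      also have "\<dots> = (norm (x - y))\<^sup>2 - 2 * r * ((G x - G y) \<bullet> (x - y))
                      + r\<^sup>2 * (norm (G x - G y))\<^sup>2"
        unfolding power2_norm_eq_inner
        by (simp add: inner_diff_left inner_diff_right inner_commute algebra_simps
            power2_eq_square)
      also have "\<dots> \<le> (norm (x - y))\<^sup>2 - 2 * r * (m * (norm (x - y))\<^sup>2)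
                      + r\<^sup>2 * (K * norm (x - y))\<^sup>2"
        using mono[of x y] lipK[of x y] r
        by (intro add_mono diff_mono mult_left_mono power_mono) auto
      also have "\<dots> = (1 - m\<^sup>2 / K\<^sup>2) * (norm (x - y))\<^sup>2"
        using K by (simp add: r_def field_simps power2_eq_square)
      also have "\<dots> = (q * norm (x - y))\<^sup>2"
        using ratio by (simp add: q_def power_mult_distrib)
      finally have "norm (F x - F y) \<le> q * norm (x - y)"
        by (rule power2_le_imp_le) (use q in simp)
      then show ?thesis by (simp only: dist_norm)
    qed
    have "\<exists>!x. F x = x"
      using q contr by (intro banach_fix_type[of q F]) auto
    then obtain x where "F x = x" by blast
    then show "\<exists>x. b = G x"
      using r by (auto simp: F_def)
  qed
qed

section \<open>The space of square-integrable fields\<close>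

lemma L2_dominated:
  fixes u :: "'a::euclidean_space \<Rightarrow> 'b::euclidean_space"
    and w :: "'a \<Rightarrow> 'c::euclidean_space"
  assumes "u \<in> L2 \<Omega>" and "w \<in> borel_measurable (lebesgue_on \<Omega>)"
    and bound: "\<And>x. norm (w x) \<le> K * norm (u x)"
  shows "w \<in> L2 \<Omega>"
proof -
  have "integrable (lebesgue_on \<Omega>) (\<lambda>x. (norm (w x))\<^sup>2)"
  proof (rule Bochner_Integration.integrable_bound)
    show "integrable (lebesgue_on \<Omega>) (\<lambda>x. K\<^sup>2 * (norm (u x))\<^sup>2)"
      using assms(1) by (simp add: L2_def)
    show "(\<lambda>x. (norm (w x))\<^sup>2) \<in> borel_measurable (lebesgue_on \<Omega>)"
      using assms(2) by measurable
    show "AE x in lebesgue_on \<Omega>. norm ((norm (w x))\<^sup>2) \<le> norm (K\<^sup>2 * (norm (u x))\<^sup>2)"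
      using power_mono[OF bound, of _ 2] by (simp add: power_mult_distrib)
  qed
  with assms(2) show ?thesis by (simp add: L2_def)
qed

lemma L2_scaleR:
  assumes "u \<in> L2 \<Omega>"
  shows "(\<lambda>x. k *\<^sub>R u x) \<in> L2 \<Omega>"
  using assms
  by (rule L2_dominated[where K = "\<bar>k\<bar>"]) (use assms in \<open>auto simp: L2_def\<close>)

lemma L2_lipschitz_compose:
  fixes g :: "'b::euclidean_space \<Rightarrow> 'c::euclidean_space"
  assumes "u \<in> L2 \<Omega>" and "g 0 = 0"
    and lip: "\<And>x y. norm (g x - g y) \<le> K * norm (x - y)"
  shows "(\<lambda>x. g (u x)) \<in> L2 \<Omega>"
proof (rule L2_dominated[OF assms(1)])
  have "\<bar>K\<bar>-lipschitz_on UNIV g"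
  proof (rule lipschitz_onI)
    fix x y
    show "dist (g x) (g y) \<le> \<bar>K\<bar> * dist x y"
      unfolding dist_norm
      by (rule order_trans[OF lip]) (simp add: mult_right_mono)
  qed simp
  then have "g \<in> borel_measurable borel"
    by (intro borel_measurable_continuous_onI lipschitz_on_continuous_on)
  then show "(\<lambda>x. g (u x)) \<in> borel_measurable (lebesgue_on \<Omega>)"
    using assms(1) by (auto simp: L2_def intro: measurable_compose)
  show "norm (g (u x)) \<le> K * norm (u x)" for x
    using lip[of "u x" 0] assms(2) by simp
qed

lemma integrable_L2_inner:
  fixes u v :: "'a::euclidean_space \<Rightarrow> 'b::euclidean_space"
  assumes "u \<in> L2 \<Omega>" "v \<in> L2 \<Omega>"
  shows "integrable (lebesgue_on \<Omega>) (\<lambda>x. u x \<bullet> v x)"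
proof (rule Bochner_Integration.integrable_bound)
  show "integrable (lebesgue_on \<Omega>) (\<lambda>x. (norm (u x))\<^sup>2 + (norm (v x))\<^sup>2)"
    using assms by (simp add: L2_def)
  show "(\<lambda>x. u x \<bullet> v x) \<in> borel_measurable (lebesgue_on \<Omega>)"
    using assms by (auto simp: L2_def)
  have "\<bar>p \<bullet> q\<bar> \<le> (norm p)\<^sup>2 + (norm q)\<^sup>2" for p q :: 'b
  proof -
    have "\<bar>p \<bullet> q\<bar> \<le> norm p * norm q" by (rule Cauchy_Schwarz_ineq2)
    also have "\<dots> \<le> (norm p)\<^sup>2 + (norm q)\<^sup>2"
      using sum_squares_bound[of "norm p" "norm q"]
        mult_nonneg_nonneg[OF norm_ge_zero[of p] norm_ge_zero[of q]]
      by linarith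
    finally show ?thesis .
  qed
  then show "AE x in lebesgue_on \<Omega>.
      norm (u x \<bullet> v x) \<le> norm ((norm (u x))\<^sup>2 + (norm (v x))\<^sup>2)"
    by simp
qed

lemma L2_add:
  fixes u v :: "'a::euclidean_space \<Rightarrow> 'b::euclidean_space"
  assumes "u \<in> L2 \<Omega>" "v \<in> L2 \<Omega>"
  shows "(\<lambda>x. u x + v x) \<in> L2 \<Omega>"
proof -
  have "(norm (u x + v x))\<^sup>2 = (norm (u x))\<^sup>2 + 2 * (u x \<bullet> v x) + (norm (v x))\<^sup>2" for x
    by (simp add: power2_norm_eq_inner inner_add_left inner_add_right inner_commute)
  moreover have "(\<lambda>x. u x + v x) \<in> borel_measurable (lebesgue_on \<Omega>)"
    using assms by (intro borel_measurable_add) (auto simp: L2_def)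
  ultimately show ?thesis
    using assms integrable_L2_inner[OF assms] by (simp add: L2_def)
qed

lemma L2_diff:
  fixes u v :: "'a::euclidean_space \<Rightarrow> 'b::euclidean_space"
  assumes "u \<in> L2 \<Omega>" "v \<in> L2 \<Omega>"
  shows "(\<lambda>x. u x - v x) \<in> L2 \<Omega>"
  using L2_add[OF assms(1) L2_scaleR[OF assms(2), of "-1"]] by simp

lemma L2_orthogonal_all_iff:
  fixes w :: "'a::euclidean_space \<Rightarrow> 'b::euclidean_space"
  assumes "w \<in> L2 \<Omega>"
  shows "(\<forall>\<Psi> \<in> L2 \<Omega>. L2_inner \<Omega> w \<Psi> = 0) \<longleftrightarrow> (AE x in lebesgue_on \<Omega>. w x = 0)"
proof
  assume "\<forall>\<Psi> \<in> L2 \<Omega>. L2_inner \<Omega> w \<Psi> = 0"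
  then have "(LINT x|lebesgue_on \<Omega>. w x \<bullet> w x) = 0"
    using assms by (simp add: L2_inner_def)
  then have "AE x in lebesgue_on \<Omega>. w x \<bullet> w x = 0"
    using integral_nonneg_eq_0_iff_AE[OF integrable_L2_inner[OF assms assms]] by simp
  then show "AE x in lebesgue_on \<Omega>. w x = 0" by simp
next
  assume zero: "AE x in lebesgue_on \<Omega>. w x = 0"
  have "L2_inner \<Omega> w \<Psi> = 0" for \<Psi>
    unfolding L2_inner_def by (rule integral_eq_zero_AE) (use zero in auto)
  then show "\<forall>\<Psi> \<in> L2 \<Omega>. L2_inner \<Omega> w \<Psi> = 0" by simp
qed

section \<open>The polarization step\<close>

text \<open>
  Lipschitz continuity of \<open>f\<close> together with \<open>f 0 = 0\<close> keeps
  \<open>f \<circ> Q\<close> in \<open>L2\<close>, so the residual of the equation is itself an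
  admissible test function and must vanish almost everywhere.
\<close>

lemma solves_polarization_step_iff:
  fixes \<Omega> :: "(real^'d::finite) set" and f :: "real^'d \<Rightarrow> real^'d"
  assumes "f 0 = 0" and lip: "\<And>x y. norm (f x - f y) \<le> C_L * norm (x - y)"
    and Pp: "Pp \<in> L2 \<Omega>" and E: "E \<in> L2 \<Omega>"
  shows "solves_polarization_step \<Omega> f tau c dt Pp E Q \<longleftrightarrow>
    Q \<in> L2 \<Omega> \<and> (AE x in lebesgue_on \<Omega>.
      (tau / dt) *\<^sub>R Q x + f (Q x) = (tau / dt) *\<^sub>R Pp x + c *\<^sub>R E x)"
proof (cases "Q \<in> L2 \<Omega>")
  case Q: True
  define D where "D x = (Q x - Pp x) /\<^sub>R dt" for x
  define w where "w x = tau *\<^sub>R D x + f (Q x) - c *\<^sub>R E x" for x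
  have D: "D \<in> L2 \<Omega>"
    unfolding D_def by (intro L2_scaleR L2_diff Q Pp)
  have fQ: "(\<lambda>x. f (Q x)) \<in> L2 \<Omega>"
    using Q \<open>f 0 = 0\<close> lip by (rule L2_lipschitz_compose)
  have w: "w \<in> L2 \<Omega>"
    unfolding w_def by (intro L2_diff L2_add L2_scaleR D fQ E)
  have inner_w: "L2_inner \<Omega> w \<Psi> =
      tau * L2_inner \<Omega> D \<Psi> + L2_inner \<Omega> (\<lambda>x. f (Q x)) \<Psi> - c * L2_inner \<Omega> E \<Psi>"
    if "\<Psi> \<in> L2 \<Omega>" for \<Psi>
    using integrable_L2_inner[OF D that] integrable_L2_inner[OF fQ that]
      integrable_L2_inner[OF E that]
    by (simp add: L2_inner_def w_def inner_add_left inner_diff_left)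
  have "solves_polarization_step \<Omega> f tau c dt Pp E Q \<longleftrightarrow>
      (\<forall>\<Psi> \<in> L2 \<Omega>. L2_inner \<Omega> w \<Psi> = 0)"
    using Q by (auto simp: solves_polarization_step_def inner_w D_def[symmetric])
  also have "\<dots> \<longleftrightarrow> (AE x in lebesgue_on \<Omega>. w x = 0)"
    using w by (rule L2_orthogonal_all_iff)
  also have "(\<lambda>x. w x = 0) = (\<lambda>x.
      (tau / dt) *\<^sub>R Q x + f (Q x) = (tau / dt) *\<^sub>R Pp x + c *\<^sub>R E x)"
    by (simp add: w_def D_def scaleR_diff_right divide_inverse algebra_simps)
  finally show ?thesis using Q by simp
qed (simp add: solves_polarization_step_def)

theorem theorem2:
  fixes \<Omega> :: "(real^'d::finite) set"
    and f :: "real^'d \<Rightarrow> real^'d"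
    and P E :: "nat \<Rightarrow> real^'d \<Rightarrow> real^'d"
    and T eps0 mu0 tau eps_s eps_inf B omega_f C_L M :: real
    and n i :: nat
  assumes "CARD('d) = 2 \<or> CARD('d) = 3"
    and "convex_polyhedral_domain \<Omega>"
    and "T > 0" and "eps0 > 0" and "mu0 > 0" and "tau > 0" and "eps_s > 0" and "eps_inf > 0"
    and "\<And>x. f differentiable (at x)" and "continuous_on UNIV (\<lambda>x. jacobian f (at x))"
    and "f 0 = 0"
    and "B > 0"
    and "\<And>x \<xi>. \<xi> \<noteq> 0 \<Longrightarrow> 0 < \<xi> \<bullet> (jacobian f (at x) *v \<xi>) \<and>
                          \<xi> \<bullet> (jacobian f (at x) *v \<xi>) < B * (norm \<xi>)\<^sup>2"
    and "omega_f > 0" and "C_L > 0" and "M > 0"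
    and "\<And>x y. (f x - f y) \<bullet> (x - y) \<ge> omega_f * (norm (x - y))\<^sup>2"
    and "\<And>x y. norm (f x - f y) \<le> C_L * norm (x - y)"
    and "\<And>x. norm (f x) \<le> M * norm x"
    and "n > 0" and "1 \<le> i" and "i \<le> n"
    and "P (i - 1) \<in> L2 \<Omega>" and "E i \<in> H0_curl \<Omega>"
  shows "\<exists>Q. solves_polarization_step \<Omega> f tau (eps0 * (eps_s - eps_inf)) (T / real n) (P (i - 1)) (E i) Q \<and>
           (\<forall>R. solves_polarization_step \<Omega> f tau (eps0 * (eps_s - eps_inf)) (T / real n) (P (i - 1)) (E i) R
                \<longrightarrow> (AE x in lebesgue_on \<Omega>. R x = Q x))"
proof -
  define a where "a = tau / (T / real n)"
  define G where "G p = a *\<^sub>R p + f p" for p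
  define b where "b x = a *\<^sub>R P (i - 1) x + (eps0 * (eps_s - eps_inf)) *\<^sub>R E i x" for x
  define Q where "Q x = inv G (b x)" for x
  have a: "a > 0"
    using assms by (simp add: a_def)
  have G0: "G 0 = 0" using \<open>f 0 = 0\<close> by (simp add: G_def)
  have mono: "(G x - G y) \<bullet> (x - y) \<ge> a * (norm (x - y))\<^sup>2" for x y
  proof -
    have "(G x - G y) \<bullet> (x - y) = a * (norm (x - y))\<^sup>2 + (f x - f y) \<bullet> (x - y)"
      by (simp add: G_def power2_norm_eq_inner inner_diff_left inner_diff_right inner_add_left
          algebra_simps)
    moreover have "0 \<le> omega_f * (norm (x - y))\<^sup>2"
      using \<open>omega_f > 0\<close> by simp
    ultimately show ?thesis using assms(17)[where x = x and y = y] by linarith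
  qed
  have lip: "norm (G x - G y) \<le> (a + C_L) * norm (x - y)" for x y
  proof -
    have "norm (G x - G y) = norm (a *\<^sub>R (x - y) + (f x - f y))"
      by (simp add: G_def algebra_simps)
    also have "\<dots> \<le> a * norm (x - y) + norm (f x - f y)"
      using norm_triangle_ineq[of "a *\<^sub>R (x - y)" "f x - f y"] a by simp
    also have "\<dots> \<le> (a + C_L) * norm (x - y)"
      using assms(18)[where x = x and y = y] by (simp add: algebra_simps)
    finally show ?thesis .
  qed
  have bij: "bij G"
    using a mono lip by (rule strongly_monotone_lipschitz_bij)
  have inv_lip: "norm (inv G p - inv G q) \<le> (1 / a) * norm (p - q)" for p q
    using strongly_monotone_expanding[of a G "inv G p" "inv G q"] mono a
    by (simp add: surj_f_inv_f[OF bij_is_surj[OF bij]] field_simps)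
  have inv0: "inv G 0 = 0"
    using G0 by (metis bij bij_is_inj inv_f_f)
  have E: "E i \<in> L2 \<Omega>" using assms(24) by (simp add: H0_curl_def)
  have b: "b \<in> L2 \<Omega>"
    unfolding b_def by (intro L2_add L2_scaleR assms(23) E)
  have Q: "Q \<in> L2 \<Omega>"
    unfolding Q_def using b inv0 inv_lip by (rule L2_lipschitz_compose)
  have solves_iff: "solves_polarization_step \<Omega> f tau (eps0 * (eps_s - eps_inf)) (T / real n)
        (P (i - 1)) (E i) R \<longleftrightarrow> R \<in> L2 \<Omega> \<and> (AE x in lebesgue_on \<Omega>. R x = Q x)" for R
  proof -
    have "G (R x) = b x \<longleftrightarrow> R x = Q x" for x
      unfolding Q_def using bij by (metis bij_inv_eq_iff)
    then show ?thesis
      using solves_polarization_step_iff[OF \<open>f 0 = 0\<close> assms(18) assms(23) E,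
          of tau "eps0 * (eps_s - eps_inf)" "T / real n" R]
      by (simp only: a_def[symmetric] G_def[symmetric] b_def[symmetric])
  qed
  show ?thesis unfolding solves_iff using Q by (intro exI[of _ Q]) simp
qed

end
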